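(* Let $\mathbb{V}$ be an $n$-dimensional vector space, $n>1$, over a finite field of order $q$. Then the clique number and the chromatic number of the subspace sum graph $\mathcal{G}(\mathbb{V})$ are both equal to $1+q+\cdots+q^{n-1}$.
   Context: For a finite dimensional vector space $\mathbb{V}$ over a field $\mathbb{F}$ with $\dim(\mathbb{V})>1$, the subspace sum graph $\mathcal{G}(\mathbb{V})$ is the graph whose vertices are the non-trivial proper subspaces of $\mathbb{V}$ (subspaces $W$ with $W\neq\{0\}$ and $W\neq\mathbb{V}$), two vertices $W_1,W_2$ being adjacent if and only if $W_1+W_2=\mathbb{V}$. The clique number is the maximum size of a set of pairwise adjacent vertices, and the chromatic number is the minimum number of colours in a proper vertex colouring. *)

theory Defs
  imports Complex_Main "HOL-Library.Ramsey" "HOL-Library.Set_Algebras"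
begin

text \<open>A graph is given by its vertex set \<open>V\<close> and its set \<open>E\<close> of two-element edges, as in
  \<^theory>\<open>HOL-Library.Ramsey\<close>.  Both invariants are meant for finite \<open>V\<close>; if \<open>V\<close> is infinite,
  the maximum or the minimum need not exist and the value is then unspecified.\<close>

definition clique_number :: "'a set \<Rightarrow> 'a set set \<Rightarrow> nat" where
  "clique_number V E = Max {card C |C. C \<subseteq> V \<and> clique C E}"

definition proper_colouring :: "'a set \<Rightarrow> 'a set set \<Rightarrow> ('a \<Rightarrow> nat) \<Rightarrow> bool" where
  "proper_colouring V E c \<longleftrightarrow> (\<forall>v\<in>V. \<forall>w\<in>V. {v, w} \<in> E \<longrightarrow> c v \<noteq> c w)"

definition chromatic_number :: "'a set \<Rightarrow> 'a set set \<Rightarrow> nat" where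
  "chromatic_number V E = (LEAST k. \<exists>c. proper_colouring V E c \<and> c ` V \<subseteq> {..<k})"

text \<open>The vector space is the whole type \<open>'v\<close> with scalar multiplication \<open>scale\<close>.\<close>

definition ssg_verts :: "('f::field \<Rightarrow> 'v::ab_group_add \<Rightarrow> 'v) \<Rightarrow> 'v set set" where
  "ssg_verts scale = {W. module.subspace scale W \<and> W \<noteq> {0} \<and> W \<noteq> UNIV}"

text \<open>\<open>W1 + W2\<close> is the elementwise sum of sets from \<^theory>\<open>HOL-Library.Set_Algebras\<close>.  The
  condition \<open>W1 \<noteq> W2\<close> excludes nothing, since \<open>W + W = W \<noteq> UNIV\<close> for every vertex \<open>W\<close>.\<close>

definition ssg_edges :: "('f::field \<Rightarrow> 'v::ab_group_add \<Rightarrow> 'v) \<Rightarrow> 'v set set set" where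
  "ssg_edges scale = {{W1, W2} |W1 W2.
     W1 \<in> ssg_verts scale \<and> W2 \<in> ssg_verts scale \<and> W1 \<noteq> W2 \<and> W1 + W2 = UNIV}"

end

theory Submission
  imports Defs
begin

text \<open>Both invariants are equal to the number of hyperplanes of \<open>V\<close>.

  Two distinct hyperplanes span \<open>V\<close>, so the hyperplanes form a clique
  (\<open>sum_of_distinct_kernels\<close>).  Conversely, every proper subspace lies in some hyperplane
  (\<open>proper_subspace_le_hyperplane\<close>), and choosing one such hyperplane as the colour of each vertex
  gives a proper colouring: two subspaces of a common hyperplane have their sum in it, and are
  not adjacent.  A clique and a proper colouring of the same size force the clique number and the
  chromatic number to be this size (\<open>clique_chromatic_eqI\<close>).

  The hyperplanes are counted by duality.  They are the kernels of the nonzero linear functionals.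
  A functional is determined by its arbitrary values on a basis, so there are \<open>q ^ n - 1\<close> nonzero
  ones, and two of them have the same kernel iff they are proportional, so that each hyperplane is
  the kernel of exactly \<open>q - 1\<close> of them (\<open>card_hyperplanes\<close>).\<close>

section \<open>Cliques and colourings\<close>

lemma colouring_inj_on_clique:
  assumes "clique C E" "C \<subseteq> V" "proper_colouring V E c"
  shows "inj_on c C"
proof (rule inj_onI, rule ccontr)
  fix v w assume "v \<in> C" "w \<in> C" "c v = c w" "v \<noteq> w"
  moreover from this have "{v, w} \<in> E" using assms(1) by (simp add: clique_def)
  ultimately show False using assms(2,3) unfolding proper_colouring_def by blast
qed

lemma clique_chromatic_eqI:
  assumes C: "clique C E" "C \<subseteq> V" "card C = N"
    and c: "proper_colouring V E c" "c ` V \<subseteq> {..<N}"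
  shows "clique_number V E = N \<and> chromatic_number V E = N"
proof
  have le: "card D \<le> k"
    if "clique D E" "D \<subseteq> V" "proper_colouring V E d" "d ` V \<subseteq> {..<k}" for D d k
  proof -
    have "inj_on d D" by (rule colouring_inj_on_clique[OF that(1-3)])
    moreover have "d ` D \<subseteq> {..<k}" using that(2,4) by (auto simp: image_subset_iff)
    ultimately show ?thesis using card_inj_on_le[of d D "{..<k}"] by simp
  qed
  let ?S = "{card C |C. C \<subseteq> V \<and> clique C E}"
  have bound: "m \<le> N" if m: "m \<in> ?S" for m
  proof -
    obtain D where "m = card D" "D \<subseteq> V" "clique D E" using m by auto
    then show ?thesis using le[OF _ _ c, of D] by simp
  qed
  then have "finite ?S" by (meson finite_nat_set_iff_bounded_le)
  moreover have "N \<in> ?S" using C by auto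
  ultimately show "clique_number V E = N"
    unfolding clique_number_def using bound by (intro Max_eqI) simp_all
  show "chromatic_number V E = N"
    unfolding chromatic_number_def
  proof (rule Least_equality)
    show "\<exists>d. proper_colouring V E d \<and> d ` V \<subseteq> {..<N}" using c by blast
  next
    fix k assume "\<exists>d. proper_colouring V E d \<and> d ` V \<subseteq> {..<k}"
    then show "N \<le> k" using le[OF C(1,2)] C(3) by metis
  qed
qed

section \<open>Linear functionals and their kernels\<close>

definition nonzero_functionals :: "('f::field \<Rightarrow> 'v::ab_group_add \<Rightarrow> 'v) \<Rightarrow> ('v \<Rightarrow> 'f) set" where
  "nonzero_functionals scale = {f. Vector_Spaces.linear scale (*) f \<and> f \<noteq> (\<lambda>_. 0)}"

text \<open>Hyperplanes are represented as kernels, rather than as subspaces of codimension one, since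
  both their count and the fact that two of them span the space are read off from functionals.\<close>

definition hyperplanes :: "('f::field \<Rightarrow> 'v::ab_group_add \<Rightarrow> 'v) \<Rightarrow> 'v set set" where
  "hyperplanes scale = (\<lambda>f. {x. f x = 0}) ` nonzero_functionals scale"

context vector_space
begin

lemma vector_space_pair_field: "vector_space_pair scale ((*) :: 'a \<Rightarrow> 'a \<Rightarrow> 'a)"
  by unfold_locales (simp_all add: algebra_simps)

interpretation dual: vector_space_pair scale "(*) :: 'a \<Rightarrow> 'a \<Rightarrow> 'a"
  by (rule vector_space_pair_field)

lemma hyperplane_subspace: "H \<in> hyperplanes scale \<Longrightarrow> subspace H"
  by (auto simp: hyperplanes_def nonzero_functionals_def intro: dual.linear_subspace_kernel)

lemma hyperplane_neq_UNIV: "H \<in> hyperplanes scale \<Longrightarrow> H \<noteq> UNIV"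
  by (auto simp: hyperplanes_def nonzero_functionals_def)

text \<open>A functional that does not vanish at \<open>v\<close> splits the space into its kernel and the line
  spanned by \<open>v\<close>.\<close>

lemma kernel_decomposition:
  assumes "Vector_Spaces.linear scale (*) f" "f v \<noteq> 0"
  shows "f (y - scale (f y / f v) v) = 0"
  using assms by (simp add: dual.linear_diff dual.linear_scale)

text \<open>A vector of one hyperplane outside the other spans a line complementary to the other.\<close>

lemma sum_of_distinct_kernels:
  assumes H: "H \<in> hyperplanes scale" "K \<in> hyperplanes scale" "H \<noteq> K"
  shows "H + K = UNIV"
proof -
  have *: "H + K = UNIV"
    if HK: "H \<in> hyperplanes scale" "K \<in> hyperplanes scale" "\<not> H \<subseteq> K" for H K
  proof -
    obtain x where x: "x \<in> H" "x \<notin> K" using \<open>\<not> H \<subseteq> K\<close> by blast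
    obtain g where g: "Vector_Spaces.linear scale (*) g" "K = {x. g x = 0}"
      using HK by (auto simp: hyperplanes_def nonzero_functionals_def)
    have "y \<in> H + K" for y
    proof -
      have "scale (g y / g x) x \<in> H" using x HK hyperplane_subspace subspace_scale by blast
      moreover have "y - scale (g y / g x) x \<in> K" using kernel_decomposition g x by simp
      ultimately have "scale (g y / g x) x + (y - scale (g y / g x) x) \<in> H + K"
        by (rule set_plus_intro)
      then show ?thesis by simp
    qed
    then show ?thesis by blast
  qed
  show ?thesis
  proof (cases "H \<subseteq> K")
    case True
    then have "\<not> K \<subseteq> H" using H by blast
    then show ?thesis using * H by (metis add.commute)
  qed (use * H in blast)
qed

text \<open>This makes the colouring by hyperplanes possible.\<close>

lemma proper_subspace_le_hyperplane:
  assumes W: "subspace W" "W \<noteq> UNIV"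
  obtains H where "H \<in> hyperplanes scale" "W \<subseteq> H"
proof -
  obtain y where y: "y \<notin> W" using W by blast
  obtain C where C: "C \<subseteq> W" "independent C" "W \<subseteq> span C"
    using maximal_independent_subset by blast
  then have "span C = W" using W span_subspace by blast
  then have "independent (insert y C)" using C y independent_insertI by blast
  \<comment> \<open>The functional that extends the indicator of \<open>y\<close> on this independent set vanishes on \<open>W\<close>.\<close>
  then obtain g where g: "Vector_Spaces.linear scale (*) g"
      "\<forall>x\<in>insert y C. g x = (if x = y then 1 else 0)"
    using dual.linear_independent_extend[of "insert y C" "\<lambda>x. if x = y then 1 else 0"] by blast
  have "g x = 0" if "x \<in> C" for x using g that C y by auto
  then have "g x = 0" if "x \<in> W" for x
    using dual.linear_eq_0_on_span[OF g(1), of C] that \<open>span C = W\<close> by blast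
  moreover have "g \<in> nonzero_functionals scale"
    using g by (auto simp: nonzero_functionals_def dest: fun_cong[of _ _ y])
  ultimately show ?thesis using that by (auto simp: hyperplanes_def)
qed

text \<open>Both functionals are determined by the common kernel and their value at one vector outside
  it, so the ratio of these values is the factor.\<close>

lemma same_kernel_imp_proportional:
  assumes f: "f \<in> nonzero_functionals scale" and g: "g \<in> nonzero_functionals scale"
    and eq: "{x. g x = 0} = {x. f x = 0}"
  obtains c where "c \<noteq> 0" "g = (\<lambda>x. c * f x)"
proof -
  have lin: "Vector_Spaces.linear scale (*) f" "Vector_Spaces.linear scale (*) g"
    using f g by (auto simp: nonzero_functionals_def)
  obtain v where v: "f v \<noteq> 0" using f by (auto simp: nonzero_functionals_def)
  then have gv: "g v \<noteq> 0" using eq by blast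
  have "g y = g v / f v * f y" for y
  proof -
    have "g (y - scale (f y / f v) v) = 0"
      using kernel_decomposition[OF lin(1) v] eq by blast
    then show ?thesis using lin by (simp add: dual.linear_diff dual.linear_scale)
  qed
  moreover have "g v / f v \<noteq> 0" using v gv by simp
  ultimately show ?thesis using that by blast
qed

lemma card_functionals_with_kernel:
  assumes "H \<in> hyperplanes scale"
  shows "card {f \<in> nonzero_functionals scale. {x. f x = 0} = H} = card (UNIV - {0} :: 'a set)"
proof -
  obtain f where f: "f \<in> nonzero_functionals scale" "H = {x. f x = 0}"
    using assms by (auto simp: hyperplanes_def)
  then obtain v where v: "f v \<noteq> 0" by (auto simp: nonzero_functionals_def)
  let ?m = "\<lambda>c x. c * f x"
  have "{g \<in> nonzero_functionals scale. {x. g x = 0} = H} = ?m ` (UNIV - {0})"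
  proof (intro equalityI subsetI)
    fix g assume "g \<in> {g \<in> nonzero_functionals scale. {x. g x = 0} = H}"
    then obtain c where "c \<noteq> 0" "g = ?m c"
      using same_kernel_imp_proportional[OF f(1), of g] f(2) by blast
    then show "g \<in> ?m ` (UNIV - {0})" by blast
  next
    fix g assume "g \<in> ?m ` (UNIV - {0})"
    then obtain c where c: "c \<noteq> 0" "g = ?m c" by blast
    have "Vector_Spaces.linear scale (*) (?m c)"
      using f dual.linear_compose_scale_right[of f c] by (simp add: nonzero_functionals_def)
    then show "g \<in> {g \<in> nonzero_functionals scale. {x. g x = 0} = H}"
      using c f v by (auto simp: nonzero_functionals_def dest: fun_cong[of _ _ v])
  qed
  moreover have "inj_on ?m (UNIV - {0})"
    using v by (auto intro!: inj_onI dest: fun_cong[of _ _ v])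
  ultimately show ?thesis by (simp add: card_image)
qed

text \<open>If a functional had kernel zero, the line complementary to the kernel would be the whole
  space.  So from dimension two on, hyperplanes are vertices of the graph.\<close>

lemma hyperplane_neq_zero:
  assumes "dim UNIV > 1" "H \<in> hyperplanes scale"
  shows "H \<noteq> {0}"
proof
  assume "H = {0}"
  then obtain f where f: "Vector_Spaces.linear scale (*) f" "f \<noteq> (\<lambda>_. 0)" "{x. f x = 0} = {0}"
    using assms by (auto simp: hyperplanes_def nonzero_functionals_def)
  then obtain v where v: "f v \<noteq> 0" by auto
  have "y \<in> span {v}" for y
  proof -
    have "y - scale (f y / f v) v = 0" using kernel_decomposition[OF f(1) v] f(3) by blast
    then have "y = scale (f y / f v) v" by simp
    then show ?thesis using span_scale[OF span_base[of v "{v}"]] by (metis singletonI)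
  qed
  then have "dim UNIV \<le> card {v}" by (intro dim_le_card) auto
  then show False using assms by simp
qed

end

section \<open>The number of hyperplanes\<close>

context finite_dimensional_vector_space
begin

interpretation dual: vector_space_pair scale "(*) :: 'a \<Rightarrow> 'a \<Rightarrow> 'a"
  by (rule vector_space_pair_field)

lemma bij_betw_functionals_basis_values:
  "bij_betw (\<lambda>f. restrict f Basis) {f. Vector_Spaces.linear scale (*) f}
     (Basis \<rightarrow>\<^sub>E (UNIV :: 'a set))"
proof (rule bij_betw_imageI)
  show "inj_on (\<lambda>f. restrict f Basis) {f. Vector_Spaces.linear scale (*) f}"
  proof (rule inj_onI, rule ext)
    fix f g :: "'b \<Rightarrow> 'a" and x
    assume *: "f \<in> {f. Vector_Spaces.linear scale (*) f}"
      "g \<in> {f. Vector_Spaces.linear scale (*) f}" "restrict f Basis = restrict g Basis"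
    then have "f b = g b" if "b \<in> Basis" for b using that by (metis restrict_apply')
    then show "f x = g x" using * span_Basis by (intro dual.linear_eq_on[of f g x Basis]) auto
  qed
  show "(\<lambda>f. restrict f Basis) ` {f. Vector_Spaces.linear scale (*) f} = Basis \<rightarrow>\<^sub>E UNIV"
  proof (intro equalityI subsetI)
    fix a :: "'b \<Rightarrow> 'a" assume a: "a \<in> Basis \<rightarrow>\<^sub>E UNIV"
    obtain g where g: "Vector_Spaces.linear scale (*) g" "\<forall>x\<in>Basis. g x = a x"
      using dual.linear_independent_extend[OF independent_Basis, of a] by blast
    have "a = restrict g Basis" using g a by (auto simp: fun_eq_iff PiE_def extensional_def)
    then show "a \<in> (\<lambda>f. restrict f Basis) ` {f. Vector_Spaces.linear scale (*) f}" using g by blast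
  qed auto
qed

context
  assumes finite_field: "finite (UNIV :: 'a set)"
begin

lemma finite_nonzero_functionals: "finite (nonzero_functionals scale)"
  and card_nonzero_functionals:
    "card (nonzero_functionals scale) = card (UNIV :: 'a set) ^ dim UNIV - 1"
proof -
  let ?L = "{f :: 'b \<Rightarrow> 'a. Vector_Spaces.linear scale (*) f}"
  have "finite (Basis \<rightarrow>\<^sub>E (UNIV :: 'a set))"
    using finite_field finite_Basis by (intro finite_PiE) auto
  then have fin: "finite ?L"
    using bij_betw_functionals_basis_values bij_betw_finite by blast
  have card: "card ?L = card (UNIV :: 'a set) ^ dim UNIV"
    using bij_betw_same_card[OF bij_betw_functionals_basis_values] finite_Basis
    by (simp add: card_PiE)
  have "nonzero_functionals scale = ?L - {\<lambda>_. 0}" by (auto simp: nonzero_functionals_def)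
  moreover have "(\<lambda>_. 0) \<in> ?L" using dual.module_hom_zero by simp
  ultimately show "finite (nonzero_functionals scale)"
    "card (nonzero_functionals scale) = card (UNIV :: 'a set) ^ dim UNIV - 1"
    using fin card by simp_all
qed

lemma finite_hyperplanes: "finite (hyperplanes scale)"
  by (simp add: hyperplanes_def finite_nonzero_functionals)

lemma card_hyperplanes: "card (hyperplanes scale) = (\<Sum>i<dim UNIV. card (UNIV :: 'a set) ^ i)"
proof -
  let ?q = "card (UNIV :: 'a set)"
  have "{0, 1} \<subseteq> (UNIV :: 'a set)" by simp
  then have "card {0, 1 :: 'a} \<le> ?q" using finite_field card_mono by blast
  then have q: "?q > 1" by simp
  have "card (nonzero_functionals scale) =
      (\<Sum>H\<in>hyperplanes scale. card {f \<in> nonzero_functionals scale. {x. f x = 0} = H})"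
    using sum.group[OF finite_nonzero_functionals finite_hyperplanes,
        of "\<lambda>f. {x. f x = 0}" "\<lambda>_. 1::nat"]
    by (simp add: hyperplanes_def)
  also have "\<dots> = card (hyperplanes scale) * (?q - 1)"
    using finite_field by (simp add: card_functionals_with_kernel)
  finally have "card (hyperplanes scale) * (?q - 1) = ?q ^ dim UNIV - 1"
    by (simp add: card_nonzero_functionals del: dim_UNIV)
  also have "\<dots> = (\<Sum>i<dim UNIV. ?q ^ i) * (?q - 1)"
  proof -
    \<comment> \<open>The geometric sum is taken over the integers, where the subtraction is not truncated.\<close>
    have "int ?q ^ dim UNIV - 1 = (int ?q - 1) * (\<Sum>i<dim UNIV. int ?q ^ i)"
      by (rule power_diff_1_eq)
    then have "int (?q ^ dim UNIV - 1) = int ((\<Sum>i<dim UNIV. ?q ^ i) * (?q - 1))"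
      using q by (simp add: of_nat_diff mult.commute del: dim_UNIV)
    then show ?thesis by (simp only: of_nat_eq_iff)
  qed
  finally show ?thesis using q by (simp del: dim_UNIV)
qed

end

end

section \<open>The subspace sum graph\<close>

lemma clique_hyperplanes:
  assumes "vector_space scale" and "hyperplanes scale \<subseteq> ssg_verts scale"
  shows "clique (hyperplanes scale) (ssg_edges scale)"
proof -
  interpret vector_space scale by fact
  have "{H, K} \<in> ssg_edges scale"
    if "H \<in> hyperplanes scale" "K \<in> hyperplanes scale" "H \<noteq> K" for H K
    unfolding ssg_edges_def using that assms(2) sum_of_distinct_kernels[OF that] by blast
  then show ?thesis unfolding clique_def by blast
qed

lemma proper_colouring_of_containing_hyperplane:
  fixes scale :: "'f::field \<Rightarrow> 'v::ab_group_add \<Rightarrow> 'v" and e :: "'v set \<Rightarrow> nat"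
  assumes "vector_space scale" and e: "inj_on e (hyperplanes scale)"
    and h: "\<And>W. W \<in> ssg_verts scale \<Longrightarrow> h W \<in> hyperplanes scale \<and> W \<subseteq> h W"
  shows "proper_colouring (ssg_verts scale) (ssg_edges scale) (\<lambda>W. e (h W))"
  unfolding proper_colouring_def
proof (intro ballI impI notI)
  interpret vector_space scale by fact
  fix W U
  assume WU: "W \<in> ssg_verts scale" "U \<in> ssg_verts scale" and "{W, U} \<in> ssg_edges scale"
    and "e (h W) = e (h U)"
  note hW = conjunct1[OF h[OF WU(1)]] and sub = conjunct2[OF h[OF WU(1)]] conjunct2[OF h[OF WU(2)]]
  have eq: "h U = h W"
    using inj_onD[OF e _ conjunct1[OF h[OF WU(2)]] hW] \<open>e (h W) = e (h U)\<close> by simp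
  obtain W1 W2 where W12: "{W, U} = {W1, W2}" "W1 + W2 = UNIV"
    using \<open>{W, U} \<in> ssg_edges scale\<close> unfolding ssg_edges_def mem_Collect_eq
    by (elim exE conjE)
  from W12(1) consider "W = W1" "U = W2" | "W = W2" "U = W1"
    unfolding doubleton_eq_iff by blast
  then have "W + U = UNIV"
    by cases (simp_all add: W12(2) add.commute[of W2 W1])
  moreover have "W + U \<subseteq> h W"
  proof
    fix x assume "x \<in> W + U"
    then obtain w u where x: "x = w + u" "w \<in> W" "u \<in> U" by (rule set_plus_elim)
    then have "w \<in> h W" "u \<in> h W" using sub eq by auto
    then show "x \<in> h W" using x(1) subspace_add[OF hyperplane_subspace[OF hW]] by simp
  qed
  ultimately show False using hyperplane_neq_UNIV[OF hW] by (simp add: top.extremum_unique)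
qed

theorem theorem6p2:
  fixes scale :: "'f::field \<Rightarrow> 'v::ab_group_add \<Rightarrow> 'v"
    and B :: "'v set" and n q :: nat
  assumes "finite (UNIV :: 'f set)" and "card (UNIV :: 'f set) = q"
    and "finite_dimensional_vector_space scale B"
    and "vector_space.dim scale (UNIV :: 'v set) = n" and "n > 1"
  shows "clique_number (ssg_verts scale) (ssg_edges scale) = (\<Sum>i<n. q ^ i)
    \<and> chromatic_number (ssg_verts scale) (ssg_edges scale) = (\<Sum>i<n. q ^ i)"
proof -
  interpret finite_dimensional_vector_space scale B by fact
  have vs: "vector_space scale" by unfold_locales
  have card: "card (hyperplanes scale) = (\<Sum>i<n. q ^ i)"
    using card_hyperplanes[OF assms(1)] assms(2,4) by simp
  have verts: "hyperplanes scale \<subseteq> ssg_verts scale"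
    using hyperplane_subspace hyperplane_neq_UNIV hyperplane_neq_zero assms(4,5)
    unfolding ssg_verts_def by blast
  have "\<exists>H. H \<in> hyperplanes scale \<and> W \<subseteq> H" if "W \<in> ssg_verts scale" for W
    using that proper_subspace_le_hyperplane[of W] unfolding ssg_verts_def by blast
  then obtain h where h: "\<And>W. W \<in> ssg_verts scale \<Longrightarrow> h W \<in> hyperplanes scale \<and> W \<subseteq> h W"
    by metis
  obtain e where e: "bij_betw e (hyperplanes scale) {..<card (hyperplanes scale)}"
    using ex_bij_betw_finite_nat[OF finite_hyperplanes[OF assms(1)]] by (auto simp: atLeast0LessThan)
  show ?thesis
  proof (rule clique_chromatic_eqI[OF clique_hyperplanes[OF vs verts] verts card])
    show "proper_colouring (ssg_verts scale) (ssg_edges scale) (\<lambda>W. e (h W))"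
      using e h by (intro proper_colouring_of_containing_hyperplane[OF vs]) (auto simp: bij_betw_def)
    show "(\<lambda>W. e (h W)) ` ssg_verts scale \<subseteq> {..<\<Sum>i<n. q ^ i}"
      using e h card by (auto simp: bij_betw_def)
  qed
qed

end
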